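(* Let $f,g\in\mathcal{O}_2=\mathbb{C}\{x,y\}$ be relatively prime, such that the $1$-form $\omega_{f/g}=g\,df-f\,dg$ has an isolated singularity at $0\in\mathbb{C}^2$. Let $[\alpha:\beta]\in\mathbb{P}^1$ and let $C_{[\alpha:\beta]}:\alpha f+\beta g=0$ be a reduced curve. Then $$\tau_{[\alpha:\beta]}(f,g)=I_0(f,g)+\tau\left(C_{[\alpha:\beta]}\right).$$
   Context: $\mathcal{O}_2=\mathbb{C}\{x,y\}$ is the ring of convergent power series. $I_0(f,g)=\dim_{\mathbb{C}}\mathcal{O}_2/(f,g)$. For a reduced plane curve germ $C:h=0$ the Tjurina number is $\tau(C)=\dim_{\mathbb{C}}\mathcal{O}_2/(h,h_x,h_y)$. The Tjurina number of the pair $(f,g)$ with respect to the fiber $C_{[\alpha:\beta]}:\alpha f+\beta g=0$ of the pencil generated by $f$ and $g$ is $$\tau_{[\alpha:\beta]}(f,g):=\dim_{\mathbb{C}}\frac{\mathcal{O}_2}{(gf_x-fg_x,\ gf_y-fg_y,\ \alpha f+\beta g)}.$$ The form $\omega_{f/g}=(gf_x-fg_x)\,dx+(gf_y-fg_y)\,dy$ has an isolated singularity at $0$ when its two coefficients have no common zero in a punctured neighbourhood of $0$. *)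

theory Defs
  imports
    "HOL-Analysis.Analysis"
    "HOL-Algebra.Algebraic_Closure_Type"
    "HOL-Computational_Algebra.Squarefree"
    "HOL-Library.Extended_Nat"
begin

subsection \<open>Convergent power series in two variables\<close>

text \<open>
  A formal power series in \<open>x\<close> and \<open>y\<close> is an element of \<^typ>\<open>complex fps fps\<close>: the outer
  variable is \<open>x\<close>, the inner one is \<open>y\<close>, so that \<open>F $ i $ j\<close> is the coefficient of \<open>x\<^sup>i y\<^sup>j\<close>.
\<close>

definition convergent_series :: "complex fps fps \<Rightarrow> bool" where
  "convergent_series F \<longleftrightarrow>
     (\<exists>r::real. r > 0 \<and> (\<lambda>(i, j). norm (fps_nth (fps_nth F i) j) * r ^ i * r ^ j) summable_on UNIV)"

text \<open>Cauchy estimates; the closure properties of convergent series follow from these.\<close>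

lemma convergent_series_iff:
  "convergent_series F \<longleftrightarrow>
     (\<exists>M R::real. R > 0 \<and> (\<forall>i j. norm (fps_nth (fps_nth F i) j) \<le> M * R ^ i * R ^ j))"
proof
  assume "convergent_series F"
  then obtain r :: real where r: "r > 0"
    and s: "(\<lambda>(i, j). norm (fps_nth (fps_nth F i) j) * r ^ i * r ^ j) summable_on UNIV"
    unfolding convergent_series_def by blast
  let ?t = "\<lambda>(i, j). norm (fps_nth (fps_nth F i) j) * r ^ i * r ^ j"
  have "norm (fps_nth (fps_nth F i) j) \<le> infsum ?t UNIV * (1 / r) ^ i * (1 / r) ^ j" for i j
  proof -
    have "sum ?t {(i, j)} \<le> infsum ?t UNIV"
      by (rule finite_sum_le_infsum[OF s]) (use r in auto)
    then have "norm (fps_nth (fps_nth F i) j) * r ^ i * r ^ j \<le> infsum ?t UNIV" by simp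
    then show ?thesis using r by (simp add: field_simps)
  qed
  then show "\<exists>M R::real. R > 0 \<and> (\<forall>i j. norm (fps_nth (fps_nth F i) j) \<le> M * R ^ i * R ^ j)"
    using r by (intro exI[of _ "infsum ?t UNIV"] exI[of _ "1 / r"]) simp
next
  assume "\<exists>M R::real. R > 0 \<and> (\<forall>i j. norm (fps_nth (fps_nth F i) j) \<le> M * R ^ i * R ^ j)"
  then obtain M R :: real where R: "R > 0"
    and b: "\<And>i j. norm (fps_nth (fps_nth F i) j) \<le> M * R ^ i * R ^ j" by blast
  let ?r = "1 / (2 * R)"
  have g: "(\<lambda>n. (1/2::real) ^ n) summable_on UNIV"
    by (intro norm_summable_imp_summable_on) (simp add: norm_power)
  have g2: "(\<lambda>(i, j). (1/2::real) ^ i * (1/2) ^ j) summable_on UNIV \<times> UNIV"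
  proof (rule summable_on_SigmaI)
    show "((\<lambda>j. case (i, j) of (i, j) \<Rightarrow> (1/2::real) ^ i * (1/2) ^ j) has_sum
            (1/2) ^ i * infsum (\<lambda>n. (1/2) ^ n) UNIV) UNIV" for i :: nat
      using has_sum_cmult_right[OF has_sum_infsum[OF g], of "(1/2) ^ i"] by simp
  qed (use summable_on_cmult_left[OF g] in auto)
  then have g3: "(\<lambda>p. M * (case p of (i, j) \<Rightarrow> (1/2::real) ^ i * (1/2) ^ j)) summable_on UNIV"
    by (intro summable_on_cmult_right) simp
  have "(\<lambda>(i, j). norm (fps_nth (fps_nth F i) j) * ?r ^ i * ?r ^ j) summable_on UNIV"
  proof (rule summable_on_comparison_test[OF g3])
    fix p :: "nat \<times> nat"
    obtain i j where p: "p = (i, j)" by (cases p)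
    have "norm (fps_nth (fps_nth F i) j) * (?r ^ i * ?r ^ j)
            \<le> (M * R ^ i * R ^ j) * (?r ^ i * ?r ^ j)"
      using R by (intro mult_right_mono b) auto
    also have "\<dots> = M * ((1/2) ^ i * (1/2) ^ j)"
      using R by (simp add: field_simps)
    finally show "(case p of (i, j) \<Rightarrow> norm (fps_nth (fps_nth F i) j) * ?r ^ i * ?r ^ j)
            \<le> M * (case p of (i, j) \<Rightarrow> (1/2) ^ i * (1/2) ^ j)"
      by (simp add: p mult.assoc)
  qed (use R in auto)
  then show "convergent_series F"
    unfolding convergent_series_def using R by (intro exI[of _ ?r]) simp
qed

lemma convergent_seriesI:
  assumes "R > 0" "\<And>i j. norm (fps_nth (fps_nth F i) j) \<le> M * R ^ i * R ^ j"
  shows "convergent_series F"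
  using assms unfolding convergent_series_iff by blast

lemma convergent_seriesE:
  assumes "convergent_series F"
  obtains M R where "M \<ge> 0" "R \<ge> (1::real)"
    "\<And>i j. norm (fps_nth (fps_nth F i) j) \<le> M * R ^ i * R ^ j"
proof -
  obtain M R :: real where R: "R > 0"
    and b: "\<And>i j. norm (fps_nth (fps_nth F i) j) \<le> M * R ^ i * R ^ j"
    using assms unfolding convergent_series_iff by blast
  have M: "M \<ge> 0" using order_trans[OF norm_ge_zero b[of 0 0]] by simp
  show thesis
  proof (rule that[of M "max 1 R"])
    fix i j
    have "M * R ^ i * R ^ j \<le> M * max 1 R ^ i * max 1 R ^ j"
      using M R by (intro mult_mono power_mono mult_nonneg_nonneg) auto
    then show "norm (fps_nth (fps_nth F i) j) \<le> M * max 1 R ^ i * max 1 R ^ j"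
      using b order_trans by blast
  qed (use M in auto)
qed

lemma convergent_series_const: "convergent_series (fps_const (fps_const c))"
  by (rule convergent_seriesI[of 1 _ "norm c"]) (auto simp: fps_const_def)

lemma convergent_series_add:
  assumes "convergent_series F" "convergent_series G"
  shows "convergent_series (F + G)"
proof -
  obtain M R where F: "M \<ge> 0" "R \<ge> (1::real)"
    "\<And>i j. norm (fps_nth (fps_nth F i) j) \<le> M * R ^ i * R ^ j"
    using convergent_seriesE[OF assms(1)] by blast
  obtain N S where G: "N \<ge> 0" "S \<ge> (1::real)"
    "\<And>i j. norm (fps_nth (fps_nth G i) j) \<le> N * S ^ i * S ^ j"
    using convergent_seriesE[OF assms(2)] by blast
  show ?thesis
  proof (rule convergent_seriesI[of "R * S" _ "M + N"])
    fix i j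
    have "M * R ^ i * R ^ j \<le> M * (R * S) ^ i * (R * S) ^ j"
      using F G by (intro mult_mono power_mono mult_nonneg_nonneg) (auto simp: mult_le_cancel_left1)
    moreover have "N * S ^ i * S ^ j \<le> N * (R * S) ^ i * (R * S) ^ j"
      using F G by (intro mult_mono power_mono mult_nonneg_nonneg) (auto simp: mult_le_cancel_right1)
    ultimately show "norm (fps_nth (fps_nth (F + G) i) j) \<le> (M + N) * (R * S) ^ i * (R * S) ^ j"
      using F(3)[of i j] G(3)[of i j]
        norm_triangle_ineq[of "fps_nth (fps_nth F i) j" "fps_nth (fps_nth G i) j"]
      by (simp add: distrib_right)
  qed (use F G in auto)
qed

lemma convergent_series_uminus: "convergent_series F \<Longrightarrow> convergent_series (- F)"
  unfolding convergent_series_def by simp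

lemma Suc_le_two_power: "real n + 1 \<le> 2 ^ n"
  using less_exp[of n] by (metis Suc_eq_plus1 Suc_leI of_nat_Suc of_nat_le_numeral_power_cancel_iff
    add.commute)

lemma convergent_series_mult:
  assumes "convergent_series F" "convergent_series G"
  shows "convergent_series (F * G)"
proof -
  obtain M R where F: "M \<ge> 0" "R \<ge> (1::real)"
    "\<And>i j. norm (fps_nth (fps_nth F i) j) \<le> M * R ^ i * R ^ j"
    using convergent_seriesE[OF assms(1)] by blast
  obtain N S where G: "N \<ge> 0" "S \<ge> (1::real)"
    "\<And>i j. norm (fps_nth (fps_nth G i) j) \<le> N * S ^ i * S ^ j"
    using convergent_seriesE[OF assms(2)] by blast
  define T where "T = R * S"
  have T: "T \<ge> 1" "R \<le> T" "S \<le> T"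
    using F G unfolding T_def by (auto simp: mult_ge1_I mult_le_cancel_left1 mult_le_cancel_right1)
  have term_le: "norm (fps_nth (fps_nth F k) l * fps_nth (fps_nth G (i - k)) (j - l))
        \<le> M * N * T ^ i * T ^ j" if "k \<le> i" "l \<le> j" for i j k l
  proof -
    have "norm (fps_nth (fps_nth F k) l) \<le> M * T ^ k * T ^ l"
      by (rule order_trans[OF F(3)]) (use F G T in \<open>intro mult_mono power_mono mult_nonneg_nonneg; auto\<close>)
    moreover have "norm (fps_nth (fps_nth G (i-k)) (j-l)) \<le> N * T ^ (i-k) * T ^ (j-l)"
      by (rule order_trans[OF G(3)]) (use F G T in \<open>intro mult_mono power_mono mult_nonneg_nonneg; auto\<close>)
    ultimately have "norm (fps_nth (fps_nth F k) l * fps_nth (fps_nth G (i - k)) (j - l))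
        \<le> (M * T ^ k * T ^ l) * (N * T ^ (i-k) * T ^ (j-l))"
      unfolding norm_mult using F T by (intro mult_mono) auto
    also have "\<dots> = M * N * (T ^ k * T ^ (i-k)) * (T ^ l * T ^ (j-l))" by (simp add: mult_ac)
    also have "\<dots> = M * N * T ^ i * T ^ j" using that by (simp flip: power_add)
    finally show ?thesis .
  qed
  show ?thesis
  proof (rule convergent_seriesI[of "2 * T" _ "M * N"])
    fix i j
    have "norm (fps_nth (fps_nth (F * G) i) j)
        = norm (\<Sum>k=0..i. \<Sum>l=0..j. fps_nth (fps_nth F k) l * fps_nth (fps_nth G (i - k)) (j - l))"
      by (simp add: fps_mult_nth fps_sum_nth)
    also have "\<dots> \<le> (\<Sum>k=0..i. \<Sum>l=0..j. M * N * T ^ i * T ^ j)"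
      by (intro sum_norm_le term_le) auto
    also have "\<dots> = (real i + 1) * (real j + 1) * (M * N * T ^ i * T ^ j)"
      by (simp add: algebra_simps)
    also have "\<dots> \<le> (2 ^ i * 2 ^ j) * (M * N * T ^ i * T ^ j)"
      using F G T by (intro mult_right_mono mult_mono Suc_le_two_power) auto
    also have "\<dots> = M * N * (2 * T) ^ i * (2 * T) ^ j"
      by (simp add: power_mult_distrib mult_ac)
    finally show "norm (fps_nth (fps_nth (F * G) i) j) \<le> M * N * (2 * T) ^ i * (2 * T) ^ j" .
  qed (use T in auto)
qed

lemma convergent_series_deriv_x:
  assumes "convergent_series F"
  shows "convergent_series (fps_deriv F)"
proof -
  obtain M R where F: "M \<ge> 0" "R \<ge> (1::real)"
    "\<And>i j. norm (fps_nth (fps_nth F i) j) \<le> M * R ^ i * R ^ j"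
    using convergent_seriesE[OF assms] by blast
  show ?thesis
  proof (rule convergent_seriesI[of "2 * R" _ "M * R"])
    fix i j
    have "fps_nth (fps_nth (fps_deriv F) i) j = of_nat (i + 1) * fps_nth (fps_nth F (i + 1)) j"
      by (simp del: of_nat_Suc of_nat_add flip: fps_of_nat)
    then have "norm (fps_nth (fps_nth (fps_deriv F) i) j)
        = (real i + 1) * norm (fps_nth (fps_nth F (i + 1)) j)"
      by (simp add: norm_mult del: of_nat_Suc)
    also have "\<dots> \<le> 2 ^ i * (M * R ^ (i + 1) * R ^ j)"
      by (intro mult_mono Suc_le_two_power F) auto
    also have "\<dots> \<le> 2 ^ i * (M * R ^ (i + 1) * (2 * R) ^ j)"
      using F by (intro mult_left_mono power_mono mult_nonneg_nonneg) auto
    finally show "norm (fps_nth (fps_nth (fps_deriv F) i) j) \<le> M * R * (2 * R) ^ i * (2 * R) ^ j"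
      by (simp add: power_mult_distrib mult_ac)
  qed (use F in auto)
qed

lemma convergent_series_deriv_y:
  assumes "convergent_series F"
  shows "convergent_series (Abs_fps (\<lambda>i. fps_deriv (fps_nth F i)))"
proof -
  obtain M R where F: "M \<ge> 0" "R \<ge> (1::real)"
    "\<And>i j. norm (fps_nth (fps_nth F i) j) \<le> M * R ^ i * R ^ j"
    using convergent_seriesE[OF assms] by blast
  show ?thesis
  proof (rule convergent_seriesI[of "2 * R" _ "M * R"])
    fix i j
    have "norm (fps_nth (fps_nth (Abs_fps (\<lambda>i. fps_deriv (fps_nth F i))) i) j)
        = (real j + 1) * norm (fps_nth (fps_nth F i) (j + 1))"
      by (simp add: norm_mult del: of_nat_Suc)
    also have "\<dots> \<le> 2 ^ j * (M * R ^ i * R ^ (j + 1))"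
      by (intro mult_mono Suc_le_two_power F) auto
    also have "\<dots> \<le> 2 ^ j * (M * (2 * R) ^ i * R ^ (j + 1))"
      using F by (intro mult_left_mono mult_right_mono power_mono mult_nonneg_nonneg) auto
    finally show "norm (fps_nth (fps_nth (Abs_fps (\<lambda>i. fps_deriv (fps_nth F i))) i) j)
        \<le> M * R * (2 * R) ^ i * (2 * R) ^ j"
      by (simp add: power_mult_distrib mult_ac)
  qed (use F in auto)
qed

text \<open>The ring \<open>\<O>\<^sub>2 = \<complex>{x, y}\<close>.\<close>

typedef conv2 = "{F :: complex fps fps. convergent_series F}"
  morphisms series_of Conv2
  using convergent_series_const by blast

setup_lifting type_definition_conv2

instantiation conv2 :: idom_divide
begin

lift_definition zero_conv2 :: conv2 is 0
  using convergent_series_const[of 0] by simp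

lift_definition one_conv2 :: conv2 is 1
  using convergent_series_const[of 1] by simp

lift_definition plus_conv2 :: "conv2 \<Rightarrow> conv2 \<Rightarrow> conv2" is "(+)"
  by (rule convergent_series_add)

lift_definition uminus_conv2 :: "conv2 \<Rightarrow> conv2" is uminus
  by (rule convergent_series_uminus)

lift_definition minus_conv2 :: "conv2 \<Rightarrow> conv2 \<Rightarrow> conv2" is "(-)"
  by (metis convergent_series_add convergent_series_uminus diff_conv_add_uminus)

lift_definition times_conv2 :: "conv2 \<Rightarrow> conv2 \<Rightarrow> conv2" is "(*)"
  by (rule convergent_series_mult)

text \<open>Division plays no role except that \<^const>\<open>coprime\<close> is only available in \<^class>\<open>algebraic_semidom\<close>.\<close>

definition divide_conv2 :: "conv2 \<Rightarrow> conv2 \<Rightarrow> conv2" where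
  "divide_conv2 f g = (if g = 0 then 0 else SOME q. f = q * g)"

instance
proof
  fix f g h :: conv2
  show cancel: "g \<noteq> 0 \<Longrightarrow> (f * g) div g = f"
  proof -
    assume g: "g \<noteq> 0"
    have "q = f" if "f * g = q * g" for q
      using that g by transfer simp
    then show ?thesis using g unfolding divide_conv2_def by (auto intro: some_equality)
  qed
  show "f div 0 = 0" by (simp add: divide_conv2_def)
qed (transfer; simp add: algebra_simps)+

end

instance conv2 :: algebraic_semidom ..

lift_definition const2 :: "complex \<Rightarrow> conv2" is "\<lambda>c. fps_const (fps_const c)"
  by (rule convergent_series_const)

lift_definition deriv_x :: "conv2 \<Rightarrow> conv2" is fps_deriv
  by (rule convergent_series_deriv_x)

lift_definition deriv_y :: "conv2 \<Rightarrow> conv2" is "\<lambda>F. Abs_fps (\<lambda>i. fps_deriv (fps_nth F i))"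
  by (rule convergent_series_deriv_y)

text \<open>The value of the series at a point; meaningful near the origin only.\<close>

definition eval2 :: "conv2 \<Rightarrow> complex \<times> complex \<Rightarrow> complex" where
  "eval2 f p = (\<Sum>\<^sub>\<infinity>(i, j). fps_nth (fps_nth (series_of f) i) j * fst p ^ i * snd p ^ j)"

subsection \<open>Dimensions of quotients\<close>

definition O2 :: "conv2 ring" where
  "O2 = ring_of_type_algebra"

text \<open>
  \<open>quot_dim S\<close> is the dimension of \<open>\<O>\<^sub>2 / (S)\<close> over the image of \<open>\<complex>\<close> in this quotient
  (if \<open>(S) = \<O>\<^sub>2\<close>, that image is zero rather than a field, and the dimension is 0).
\<close>

definition quot_dim :: "conv2 set \<Rightarrow> enat" where
  "quot_dim S =
     (let I = Idl\<^bsub>O2\<^esub> S;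
          Q = O2 Quot I;
          K = (\<lambda>c. I +>\<^bsub>O2\<^esub> const2 c) ` UNIV
      in if \<exists>n. ring.dimension Q n K (carrier Q)
         then enat (THE n. ring.dimension Q n K (carrier Q))
         else \<infinity>)"

subsection \<open>Intersection multiplicities, Tjurina numbers and the form \<open>\<omega>\<^bsub>f/g\<^esub>\<close>\<close>

definition intersection_mult :: "conv2 \<Rightarrow> conv2 \<Rightarrow> enat" where
  "intersection_mult f g = quot_dim {f, g}"

definition tjurina :: "conv2 \<Rightarrow> enat" where
  "tjurina h = quot_dim {h, deriv_x h, deriv_y h}"

definition pencil_member :: "complex \<Rightarrow> complex \<Rightarrow> conv2 \<Rightarrow> conv2 \<Rightarrow> conv2" where
  "pencil_member \<alpha> \<beta> f g = const2 \<alpha> * f + const2 \<beta> * g"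

definition omega_x :: "conv2 \<Rightarrow> conv2 \<Rightarrow> conv2" where
  "omega_x f g = g * deriv_x f - f * deriv_x g"

definition omega_y :: "conv2 \<Rightarrow> conv2 \<Rightarrow> conv2" where
  "omega_y f g = g * deriv_y f - f * deriv_y g"

definition tjurina_pencil :: "complex \<Rightarrow> complex \<Rightarrow> conv2 \<Rightarrow> conv2 \<Rightarrow> enat" where
  "tjurina_pencil \<alpha> \<beta> f g = quot_dim {omega_x f g, omega_y f g, pencil_member \<alpha> \<beta> f g}"

definition omega_isolated :: "conv2 \<Rightarrow> conv2 \<Rightarrow> bool" where
  "omega_isolated f g \<longleftrightarrow>
     (\<forall>\<^sub>F p in at (0, 0). \<not> (eval2 (omega_x f g) p = 0 \<and> eval2 (omega_y f g) p = 0))"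

end

theory Submission
  imports Defs
begin

text \<open>
  Write \<open>h = \<alpha> f + \<beta> g\<close> with \<open>\<alpha> \<noteq> 0\<close>. The ideal defining the Tjurina number of the pair is then
  \<open>(g h\<^sub>x, g h\<^sub>y, h)\<close>, which is contained in \<open>(f, g) = (g, h)\<close>. Multiplication by \<open>g\<close> maps \<open>\<O>\<^sub>2\<close> onto
  \<open>(g, h) / (g h\<^sub>x, g h\<^sub>y, h)\<close>, and its kernel is \<open>(h, h\<^sub>x, h\<^sub>y)\<close> because \<open>h\<close> divides \<open>b\<close> whenever it
  divides \<open>g b\<close>; additivity of dimensions gives the formula. The cancellation of \<open>g\<close> is only needed
  when \<open>\<O>\<^sub>2 / (g, h)\<close> is finite-dimensional, as both sides are infinite otherwise, and in that case it
  needs no unique factorisation: \<open>(g, h)\<close> contains a power of \<open>x\<close> and an element not divisible by \<open>x\<close>.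
\<close>

subsection \<open>Relative dimension of subspaces\<close>

locale relative_dimension = vector_space scale
  for scale :: "'a::field \<Rightarrow> 'b::ab_group_add \<Rightarrow> 'b"
begin

text \<open>\<open>rel_dim n U V\<close> means that \<open>U \<subseteq> V\<close> are subspaces and the quotient \<open>V / U\<close> has dimension \<open>n\<close>.\<close>

inductive rel_dim :: "nat \<Rightarrow> 'b set \<Rightarrow> 'b set \<Rightarrow> bool" where
  rel_dim_0: "subspace U \<Longrightarrow> rel_dim 0 U U"
| rel_dim_Suc: "rel_dim n U V \<Longrightarrow> v \<notin> V \<Longrightarrow> rel_dim (Suc n) U (span (insert v V))"

lemma rel_dim_subspace:
  assumes "rel_dim n U V"
  shows "subspace U" "subspace V" "U \<subseteq> V"
  using assms by (induction rule: rel_dim.induct) (auto intro: span_base)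

lemma mem_span_insert_subspace:
  "subspace V \<Longrightarrow> x \<in> span (insert v V) \<longleftrightarrow> (\<exists>k. x - scale k v \<in> V)"
  by (metis span_breakdown_eq span_eq_iff)

lemma rel_dim_trans: "rel_dim m V W \<Longrightarrow> rel_dim n U V \<Longrightarrow> rel_dim (n + m) U W"
  by (induction rule: rel_dim.induct) (auto intro: rel_dim_Suc)

text \<open>Adding \<open>W\<close> to every subspace of a chain from \<open>U\<close> to
  \<open>V\<close> turns each step into a step of dimension one or no step at all. With
  \<open>V = UNIV\<close> this passes finite codimension from \<open>U\<close> to any larger
  subspace.\<close>

lemma rel_dim_sup:
  assumes "rel_dim n U V" "subspace W" "U \<subseteq> W"
  shows "\<exists>m. rel_dim m W (span (V \<union> W))"
  using assms
proof (induction rule: rel_dim.induct)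
  case (rel_dim_0 U)
  then show ?case by (metis rel_dim.rel_dim_0 span_eq_iff sup.absorb2)
next
  case (rel_dim_Suc n U V v)
  then obtain m where m: "rel_dim m W (span (V \<union> W))" by blast
  have "span (span (insert v V) \<union> W) = span (insert v (span (V \<union> W)))"
    unfolding span_eq
  proof safe
    have "insert v V \<subseteq> span (insert v (span (V \<union> W)))"
      by (auto intro: span_base)
    then show "x \<in> span (insert v (span (V \<union> W)))" if "x \<in> span (insert v V)" for x
      using that span_minimal subspace_span by blast
    have "V \<union> W \<subseteq> span (span (insert v V) \<union> W)"
      by (auto intro: span_base)
    then show "x \<in> span (span (insert v V) \<union> W)" if "x \<in> span (V \<union> W)" for x
      using that span_minimal subspace_span by blast
  qed (auto intro: span_base)
  then show ?case
    using m rel_dim.rel_dim_Suc[OF m] span_redundant span_span by metis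
qed

text \<open>A model of the quotient by \<open>U\<close> inside the space itself, so that the exchange lemma applies.\<close>

lemma subspace_kernel_exists:
  assumes "subspace U"
  obtains q where "module_hom scale scale q" "\<And>x. q x = 0 \<longleftrightarrow> x \<in> U"
proof -
  interpret pair: vector_space_pair scale scale ..
  \<comment> \<open>\<open>p\<close> is a projection onto \<open>U\<close>, so the complementary
    projection \<open>x - p x\<close> has kernel exactly \<open>U\<close>.\<close>
  obtain p where p: "p ` UNIV \<subseteq> U" "Vector_Spaces.linear scale scale p" "\<forall>v\<in>U. p v = v"
    using pair.linear_exists_left_inverse_on[OF linear_ident assms] by (auto simp: inj_on_def)
  interpret p: Vector_Spaces.linear scale scale p by (rule p(2))
  show thesis
  proof
    show "module_hom scale scale (\<lambda>x. x - p x)"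
      by unfold_locales (auto simp: p.add p.scale scale_right_diff_distrib)
    show "x - p x = 0 \<longleftrightarrow> x \<in> U" for x
      using p by (metis eq_iff_diff_eq_0 image_subset_iff UNIV_I)
  qed
qed

lemma rel_dim_image_basis:
  assumes "rel_dim n U V" "module_hom scale scale q" "\<And>x. q x = 0 \<longleftrightarrow> x \<in> U"
  shows "\<exists>B. finite B \<and> card B = n \<and> independent B \<and> span B = q ` V"
  using assms
proof (induction rule: rel_dim.induct)
  case (rel_dim_0 U)
  then have "q ` U = {0}" using subspace_0 by force
  then show ?case by (intro exI[of _ "{}"]) (auto simp: independent_empty)
next
  case (rel_dim_Suc n U V v)
  then obtain B where B: "finite B" "card B = n" "independent B" "span B = q ` V" by blast
  interpret q: module_hom scale scale q by fact
  have "q v \<notin> q ` V"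
  proof
    assume "q v \<in> q ` V"
    then obtain w where w: "w \<in> V" "q (v - w) = 0" by (auto simp: q.diff)
    then have "v - w \<in> V" using rel_dim_Suc rel_dim_subspace by blast
    then show False using w rel_dim_Suc(1,2) rel_dim_subspace subspace_add by (metis diff_add_cancel)
  qed
  then have "q v \<notin> span B" "q v \<notin> B" using B span_base by auto
  moreover have "q ` span (insert v V) = span (insert (q v) B)"
  proof -
    have "span (insert (q v) B) = span (insert (q v) (span B))"
      unfolding span_eq by (auto intro: span_base span_mono[THEN subsetD, rotated])
    then show ?thesis by (simp add: q.span_image[symmetric] B)
  qed
  ultimately show ?case using B
    by (intro exI[of _ "insert (q v) B"]) (auto simp: independent_insertI)
qed

text \<open>After a map with kernel \<open>U\<close>, a basis of the image of \<open>V\<close> is an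
  independent set in the span of a basis of the image of \<open>W\<close>, so the exchange lemma
  compares the sizes.\<close>

lemma rel_dim_mono:
  assumes "rel_dim m U V" "rel_dim n U W" "V \<subseteq> W"
  shows "m \<le> n"
proof -
  obtain q where q: "module_hom scale scale q" "\<And>x. q x = 0 \<longleftrightarrow> x \<in> U"
    using subspace_kernel_exists rel_dim_subspace(1)[OF assms(1)] by blast
  obtain B C where "finite B" "card B = m" "independent B" "span B = q ` V"
    and "finite C" "card C = n" "span C = q ` W"
    using rel_dim_image_basis assms(1,2) q by metis
  then show ?thesis
    using independent_span_bound[of C B] assms(3) span_superset[of B] by blast
qed

lemma rel_dim_unique: "rel_dim m U V \<Longrightarrow> rel_dim n U V \<Longrightarrow> m = n"
  by (meson rel_dim_mono order.refl antisym)

text \<open>The map induced by \<open>q\<close> on the quotients is injective, so along a chain from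
  \<open>U\<close> to \<open>V\<close> each preimage either stays the same or grows by one vector.
  Only finiteness of the resulting dimension is claimed.\<close>

lemma rel_dim_vimage:
  assumes "rel_dim n U V" "module_hom scale scale q"
  shows "\<exists>m. rel_dim m (q -` U) (q -` V)"
  using assms
proof (induction rule: rel_dim.induct)
  case (rel_dim_0 U)
  then show ?case using rel_dim.rel_dim_0 module_hom.subspace_vimage by blast
next
  case (rel_dim_Suc n U V v)
  interpret q: module_hom scale scale q by fact
  obtain m where m: "rel_dim m (q -` U) (q -` V)" using rel_dim_Suc by blast
  have V: "subspace V" using rel_dim_Suc rel_dim_subspace by blast
  have V': "subspace (q -` V)" using V by (rule q.subspace_vimage)
  have sub: "q -` V \<subseteq> q -` span (insert v V)" by (auto intro: span_base)
  show ?case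
  proof (cases "q -` span (insert v V) \<subseteq> q -` V")
    case True
    then show ?thesis using m sub by (metis subset_antisym)
  next
    case False
    then obtain u where u: "q u \<in> span (insert v V)" "q u \<notin> V" by blast
    then obtain k where k: "q u - scale k v \<in> V"
      using mem_span_insert_subspace[OF V] by blast
    then have "k \<noteq> 0" using u by auto
    have "q -` span (insert v V) = span (insert u (q -` V))"
    proof (intro subset_antisym subsetI)
      fix x assume "x \<in> q -` span (insert v V)"
      then have "q x \<in> span (insert v V)" by simp
      then obtain l where l: "q x - scale l v \<in> V"
        using mem_span_insert_subspace[OF V] by blast
      \<comment> \<open>The factor \<open>l / k\<close> makes the two multiples of \<open>v\<close>
        cancel, so that \<open>u\<close> takes over the role of \<open>v\<close> upstairs.\<close>
      have "(q x - scale l v) - scale (l / k) (q u - scale k v) \<in> V"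
        by (rule subspace_diff[OF V l subspace_scale[OF V k]])
      then have "x - scale (l / k) u \<in> q -` V"
        using \<open>k \<noteq> 0\<close> by (simp add: q.diff q.scale algebra_simps)
      then show "x \<in> span (insert u (q -` V))"
        using mem_span_insert_subspace[OF V'] by blast
    next
      fix x assume "x \<in> span (insert u (q -` V))"
      then obtain l where "x - scale l u \<in> q -` V"
        using mem_span_insert_subspace[OF V'] by blast
      then have "q x - scale l (q u) \<in> span (insert v V)"
        by (auto simp: q.diff q.scale intro: span_base)
      then have "q x \<in> span (insert v V)"
        using u span_add span_scale by (metis diff_add_cancel)
      then show "x \<in> q -` span (insert v V)" by simp
    qed
    then show ?thesis using m rel_dim.rel_dim_Suc[OF m, of u] u by auto
  qed
qed

text \<open>Because \<open>T\<close> is the full preimage of \<open>J\<close>, \<open>q\<close> is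
  injective modulo \<open>T\<close> and \<open>J\<close>; a vector outside \<open>V\<close>
  therefore stays outside the image of \<open>V\<close> plus \<open>J\<close>, and no dimension is
  lost.\<close>

lemma rel_dim_image:
  assumes "rel_dim n T V" "module_hom scale scale q" "subspace J" "q -` J = T"
  shows "rel_dim n J (span (q ` V \<union> J))"
  using assms
proof (induction rule: rel_dim.induct)
  case (rel_dim_0 T)
  then have "q ` T \<union> J = J" by blast
  then show ?case using rel_dim_0 by (metis rel_dim.rel_dim_0 span_eq_iff)
next
  case (rel_dim_Suc n T V v)
  interpret q: module_hom scale scale q by fact
  have V: "subspace V" "T \<subseteq> V" using rel_dim_Suc rel_dim_subspace by blast+
  have "q v \<notin> span (q ` V \<union> J)"
  proof
    assume "q v \<in> span (q ` V \<union> J)"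
    then obtain w j where w: "w \<in> V" "j \<in> J" "q v = q w + j"
      using V rel_dim_Suc.prems(2) q.subspace_image
      by (auto simp: span_Un span_eq_iff[THEN iffD2])
    then have "v - w \<in> V" using V rel_dim_Suc.prems by (auto simp: q.diff)
    then show False using w rel_dim_Suc V subspace_add by (metis diff_add_cancel)
  qed
  moreover have "span (q ` span (insert v V) \<union> J) = span (insert (q v) (span (q ` V \<union> J)))"
  proof -
    have "q ` V \<subseteq> span (q ` V \<union> J)" by (auto intro: span_base)
    then have "span (q ` insert v V) \<subseteq> span (insert (q v) (span (q ` V \<union> J)))"
      by (intro span_minimal) (auto intro: span_base)
    moreover have "span (q ` V \<union> J) \<subseteq> span (span (q ` insert v V) \<union> J)"
      by (intro span_mono) (auto intro: span_base)
    ultimately show ?thesis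
      unfolding q.span_image[symmetric] span_eq
      by (auto intro: span_base)
  qed
  ultimately show ?case using rel_dim_Suc rel_dim.rel_dim_Suc by metis
qed

end

subsection \<open>Divisibility by powers of \<open>x\<close> and units\<close>

lift_definition var_x :: conv2 is fps_X
  by (rule convergent_seriesI[of 1 _ 1]) (auto simp: fps_X_def)

lift_definition var_y :: conv2 is "fps_const fps_X"
  by (rule convergent_seriesI[of 1 _ 1]) (auto simp: fps_X_def)

lemma const2_1 [simp]: "const2 1 = 1"
  by transfer simp

lemma const2_add: "const2 (a + b) = const2 a + const2 b"
  by transfer simp

lemma const2_mult: "const2 (a * b) = const2 a * const2 b"
  by transfer simp

lemma var_x_power_dvd_iff:
  "var_x ^ k dvd s \<longleftrightarrow> (\<forall>i<k. fps_nth (series_of s) i = 0)"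
proof
  have X: "series_of (var_x ^ k) = fps_X ^ k"
    by (induction k) (simp_all add: one_conv2.rep_eq times_conv2.rep_eq var_x.rep_eq)
  show "\<forall>i<k. fps_nth (series_of s) i = 0" if "var_x ^ k dvd s"
    using that X by (auto simp: times_conv2.rep_eq fps_X_power_mult_nth)
  assume 0: "\<forall>i<k. fps_nth (series_of s) i = 0"
  define T where "T = fps_shift k (series_of s)"
  have "convergent_series (series_of s)" using series_of[of s] by simp
  then obtain M R where MR: "M \<ge> 0" "R \<ge> (1::real)"
    "\<And>i j. norm (fps_nth (fps_nth (series_of s) i) j) \<le> M * R ^ i * R ^ j"
    using convergent_seriesE by blast
  have "convergent_series T"
  proof (rule convergent_seriesI[of R _ "M * R ^ k"])
    \<comment> \<open>Shifting by \<open>k\<close> costs only the fixed factor \<open>R ^ k\<close>,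
      which goes into the constant.\<close>
    show "norm (fps_nth (fps_nth T i) j) \<le> M * R ^ k * R ^ i * R ^ j" for i j
      using MR(3)[of "i + k" j] by (simp add: T_def power_add mult_ac)
  qed (use MR in auto)
  then have "series_of (Conv2 T) = T" by (simp add: Conv2_inverse)
  moreover have "series_of s = fps_X ^ k * T"
    using 0 by (intro fps_ext) (auto simp: fps_X_power_mult_nth T_def)
  ultimately have "s = var_x ^ k * Conv2 T"
    by (simp add: series_of_inject[symmetric] times_conv2.rep_eq X)
  then show "var_x ^ k dvd s" by simp
qed

text \<open>The coefficients with respect to powers of \<open>x\<close> lie in an integral domain,
  and that of \<open>x ^ 0\<close> in \<open>u\<close> is nonzero; so the coefficients of
  \<open>s\<close> below \<open>x ^ k\<close> vanish one after the other.\<close>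

lemma var_x_power_dvd_mult_cancel:
  assumes "var_x ^ k dvd s * u" "fps_nth (series_of u) 0 \<noteq> 0"
  shows "var_x ^ k dvd s"
proof -
  have "fps_nth (series_of s) i = 0" if "i < k" for i
    using that
  proof (induction i rule: less_induct)
    case (less i)
    have "0 = fps_nth (series_of (s * u)) i"
      using assms(1) less by (simp add: var_x_power_dvd_iff)
    also have "\<dots> = (\<Sum>l\<in>{0..i}. fps_nth (series_of s) l * fps_nth (series_of u) (i - l))"
      by (simp add: times_conv2.rep_eq fps_mult_nth)
    also have "\<dots> = (\<Sum>l\<in>{i}. fps_nth (series_of s) l * fps_nth (series_of u) (i - l))"
      using less by (intro sum.mono_neutral_right) auto
    finally show ?case using assms(2) by simp
  qed
  then show ?thesis by (simp add: var_x_power_dvd_iff)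
qed

lemma sum_geometric_quotient_le:
  fixes r :: real
  assumes "r > 0"
  shows "(\<Sum>k=1..i. (1 / (1 + r)) ^ k) \<le> 1 / r"
proof -
  define q where "q = 1 / (1 + r)"
  have q: "0 < q" "q < 1" using assms by (auto simp: q_def)
  have "(\<Sum>k=1..i. q ^ k) = (\<Sum>k<i. q * q ^ k)"
    by (rule sum.reindex_bij_witness[of _ Suc "\<lambda>k. k - 1"]) (auto simp flip: power_Suc)
  also have "\<dots> = q * ((1 - q ^ i) / (1 - q))"
    using q by (simp add: sum_gp_strict flip: sum_distrib_left)
  also have "\<dots> \<le> q * (1 / (1 - q))"
    using q by (intro mult_left_mono divide_right_mono) auto
  also have "\<dots> = 1 / r" using assms by (simp add: q_def field_simps)
  finally show ?thesis by (simp add: q_def)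
qed

text \<open>
  The inverse satisfies \<open>H = 1 + G H\<close>. Growing \<open>S\<close> faster than \<open>R\<close> in the \<open>x\<close>-direction turns
  this recursion into the bound \<open>S\<^sup>i (2R)\<^sup>j\<close> by a geometric sum.
\<close>

lemma one_minus_var_x_mult_unit: "1 - var_x * s dvd 1"
proof -
  define G where "G = series_of (var_x * s)"
  define H where "H = fps_right_inverse (1 - G) 1"
  have G0: "fps_nth G 0 = 0"
    by (simp add: G_def times_conv2.rep_eq var_x.rep_eq)
  have H: "H * (1 - G) = 1"
    using fps_right_inverse[of "1 - G" 1] G0 by (simp add: H_def mult.commute)
  have "convergent_series G" using series_of unfolding G_def by auto
  then obtain M R where MR: "M \<ge> 0" "R \<ge> (1::real)"
    "\<And>i j. norm (fps_nth (fps_nth G i) j) \<le> M * R ^ i * R ^ j"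
    using convergent_seriesE by blast
  \<comment> \<open>The ratio \<open>R / S\<close> is \<open>1 / (1 + 2 * (M + 1))\<close>, whose
    geometric sum is at most \<open>1 / (2 * (M + 1))\<close>; this cancels the factor
    \<open>2 * (M + 1)\<close> that the recursion produces. Using \<open>M + 1\<close> for
    \<open>M\<close> avoids dividing by zero.\<close>
  define S where "S = R * (1 + 2 * (M + 1))"
  have S: "S \<ge> R" "S > 0" using MR by (auto simp: S_def mult_le_cancel_left1)
  \<comment> \<open>As \<open>G\<close> has no term in \<open>x ^ 0\<close>, the recursion for
    \<open>H\<close> at \<open>i\<close> refers to smaller indices only.\<close>
  have rec: "fps_nth H i = (if i = 0 then 1 else 0) + (\<Sum>k=1..i. fps_nth G k * fps_nth H (i - k))" for i
  proof -
    have "H = 1 + G * H" using H by (simp add: algebra_simps)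
    then have "fps_nth H i = fps_nth (1 + G * H) i" by simp
    also have "\<dots> = (if i = 0 then 1 else 0) + (\<Sum>k=0..i. fps_nth G k * fps_nth H (i - k))"
      by (simp add: fps_mult_nth)
    also have "(\<Sum>k=0..i. fps_nth G k * fps_nth H (i - k)) = (\<Sum>k=1..i. fps_nth G k * fps_nth H (i - k))"
      using G0 by (simp add: sum.atLeast_Suc_atMost)
    finally show ?thesis .
  qed
  have bound: "norm (fps_nth (fps_nth H i) j) \<le> S ^ i * (2 * R) ^ j" for i j
  proof (induction i arbitrary: j rule: less_induct)
    case (less i)
    show ?case
    proof (cases "i = 0")
      case True
      then show ?thesis using rec[of 0] MR by (cases j) auto
    next
      case False
      \<comment> \<open>With \<open>2 * R\<close> in the \<open>y\<close>-direction the convolution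
        is dominated by a geometric sum of ratio 1/2 and costs a factor 2 independent of
        \<open>j\<close>.\<close>
      have inner: "(\<Sum>l=0..j. R ^ l * (2 * R) ^ (j - l)) \<le> 2 * (2 * R) ^ j"
      proof -
        have "(\<Sum>l=0..j. R ^ l * (2 * R) ^ (j - l)) = (\<Sum>l=0..j. (2 * R) ^ j * (1 / (1 + 1)) ^ l)"
          using MR by (intro sum.cong) (auto simp: power_diff power_mult_distrib power_divide field_simps)
        also have "\<dots> = (2 * R) ^ j * (1 + (\<Sum>l=1..j. (1 / (1 + 1)) ^ l))"
          by (simp add: sum.atLeast_Suc_atMost flip: sum_distrib_left)
        also have "\<dots> \<le> (2 * R) ^ j * (1 + 1 / 1)"
          using MR by (intro mult_left_mono add_left_mono sum_geometric_quotient_le) auto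
        finally show ?thesis by simp
      qed
      have outer: "norm (fps_nth (fps_nth G k * fps_nth H (i - k)) j)
          \<le> (2 * (M + 1) * S ^ i * (2 * R) ^ j) * (1 / (1 + 2 * (M + 1))) ^ k" if k: "k \<in> {1..i}" for k
      proof -
        have "norm (fps_nth (fps_nth G k * fps_nth H (i - k)) j)
            \<le> (\<Sum>l=0..j. (M * R ^ k * R ^ l) * (S ^ (i - k) * (2 * R) ^ (j - l)))"
          unfolding fps_mult_nth
        proof (rule sum_norm_le)
          show "norm (fps_nth (fps_nth G k) l * fps_nth (fps_nth H (i - k)) (j - l))
              \<le> (M * R ^ k * R ^ l) * (S ^ (i - k) * (2 * R) ^ (j - l))" for l
            unfolding norm_mult by (intro mult_mono MR(3) less.IH) (use k MR in auto)
        qed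
        also have "\<dots> = M * R ^ k * S ^ (i - k) * (\<Sum>l=0..j. R ^ l * (2 * R) ^ (j - l))"
          by (simp add: sum_distrib_left mult_ac)
        also have "\<dots> \<le> (M + 1) * R ^ k * S ^ (i - k) * (2 * (2 * R) ^ j)"
          using MR S by (intro mult_mono inner) (auto intro!: sum_nonneg)
        also have "R ^ k * S ^ (i - k) = S ^ i * (1 / (1 + 2 * (M + 1))) ^ k"
        proof -
          have "S * (1 / (1 + 2 * (M + 1))) = R" using MR by (simp add: S_def)
          then have "R ^ k = S ^ k * (1 / (1 + 2 * (M + 1))) ^ k"
            by (metis power_mult_distrib)
          moreover have "S ^ k * S ^ (i - k) = S ^ i" using k by (simp flip: power_add)
          ultimately show ?thesis by (metis mult.assoc mult.commute)
        qed
        then have "(M + 1) * R ^ k * S ^ (i - k) * (2 * (2 * R) ^ j)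
           = (2 * (M + 1) * S ^ i * (2 * R) ^ j) * (1 / (1 + 2 * (M + 1))) ^ k"
          by (simp only: mult.assoc mult.commute mult.left_commute)
        finally show ?thesis .
      qed
      have "norm (fps_nth (fps_nth H i) j) = norm (\<Sum>k=1..i. fps_nth (fps_nth G k * fps_nth H (i - k)) j)"
        using rec[of i] False by (simp add: fps_sum_nth)
      also have "\<dots> \<le> (\<Sum>k=1..i. (2 * (M + 1) * S ^ i * (2 * R) ^ j) * (1 / (1 + 2 * (M + 1))) ^ k)"
        by (intro sum_norm_le outer)
      also have "\<dots> = (2 * (M + 1) * S ^ i * (2 * R) ^ j) * (\<Sum>k=1..i. (1 / (1 + 2 * (M + 1))) ^ k)"
        by (simp add: sum_distrib_left)
      also have "\<dots> \<le> (2 * (M + 1) * S ^ i * (2 * R) ^ j) * (1 / (2 * (M + 1)))"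
        using MR S by (intro mult_left_mono sum_geometric_quotient_le) auto
      also have "\<dots> = S ^ i * (2 * R) ^ j" using MR by (simp add: field_simps)
      finally show ?thesis .
    qed
  qed
  define B where "B = max S (2 * R)"
  have B: "S \<le> B" "2 * R \<le> B" by (auto simp: B_def)
  have "convergent_series H"
  proof (rule convergent_seriesI[of B _ 1])
    fix i j
    have "S ^ i * (2 * R) ^ j \<le> B ^ i * B ^ j"
      using B MR S by (intro mult_mono power_mono) auto
    then show "norm (fps_nth (fps_nth H i) j) \<le> 1 * B ^ i * B ^ j"
      using bound[of i j] by simp
  qed (use B S in auto)
  then have "series_of (Conv2 H) = H" by (simp add: Conv2_inverse)
  then have "Conv2 H * (1 - var_x * s) = 1"
    using H by (simp add: series_of_inject[symmetric] times_conv2.rep_eq minus_conv2.rep_eq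
      one_conv2.rep_eq G_def)
  then show ?thesis by (metis dvd_triv_right)
qed

subsection \<open>Quotients of \<open>\<O>\<^sub>2\<close>\<close>

text \<open>Two structures live on the same additive group: dimensions are counted over the complex
  numbers (\<open>O2_vs\<close>), while ideals are the submodules of the ring over itself
  (\<open>O2_mod\<close>).\<close>

interpretation O2_vs: relative_dimension "\<lambda>c f. const2 c * f"
proof
  fix a b :: complex and x y :: conv2
  show "const2 a * (x + y) = const2 a * x + const2 a * y" by (rule distrib_left)
  show "const2 (a + b) * x = const2 a * x + const2 b * x" by (simp only: const2_add distrib_right)
  show "const2 a * (const2 b * x) = const2 (a * b) * x" by (simp only: const2_mult mult.assoc)
  show "const2 1 * x = x" by simp
qed

interpretation O2_mod: Modules.module "(*) :: conv2 \<Rightarrow> conv2 \<Rightarrow> conv2"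
  by unfold_locales (simp_all add: algebra_simps)

text \<open>These simp rules reassociate products against \<open>mult.assoc\<close> and make the simplifier loop.\<close>

declare O2_mod.scale_scale [simp del] O2_vs.scale_scale [simp del]

lemma O2_simps [simp]:
  "carrier O2 = UNIV" "x \<otimes>\<^bsub>O2\<^esub> y = x * y" "x \<oplus>\<^bsub>O2\<^esub> y = x + y" "\<zero>\<^bsub>O2\<^esub> = 0" "\<one>\<^bsub>O2\<^esub> = 1"
  by (simp_all add: O2_def ring_of_type_algebra_def)

lemma ring_O2: "ring O2"
  unfolding O2_def by (rule ring_from_type_algebra)

lemma ideal_O2_iff: "ideal I O2 \<longleftrightarrow> O2_mod.subspace I"
proof
  assume "ideal I O2"
  then interpret ideal I O2 .
  show "O2_mod.subspace I"
    using additive_subgroup.zero_closed[OF is_additive_subgroup]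
      additive_subgroup.a_closed[OF is_additive_subgroup] I_l_closed
    by (intro O2_mod.subspaceI) auto
next
  assume I: "O2_mod.subspace I"
  interpret ring O2 by (rule ring_O2)
  show "ideal I O2"
  proof (rule idealI[OF ring_O2])
    show "subgroup I (add_monoid O2)"
    proof (rule add.subgroupI)
      fix a assume "a \<in> I"
      then have "- a \<in> I" by (rule O2_mod.subspace_neg[OF I])
      moreover have "\<ominus>\<^bsub>O2\<^esub> a = - a" by (rule minus_equality) auto
      ultimately show "\<ominus>\<^bsub>O2\<^esub> a \<in> I" by simp
    qed (use I in \<open>auto simp: O2_mod.subspace_def\<close>)
    show "a \<otimes>\<^bsub>O2\<^esub> x \<in> I" if "a \<in> I" for a x
      using O2_mod.subspace_scale[OF I that, of x] by (simp add: mult.commute)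
  qed (use I in \<open>auto simp: O2_mod.subspace_def\<close>)
qed

lemma Idl_O2_eq_span: "Idl\<^bsub>O2\<^esub> S = O2_mod.span S"
  by (simp add: genideal_def O2_mod.span_def hull_def ideal_O2_iff)

lemma subspace_O2_mod_imp_vs: "O2_mod.subspace I \<Longrightarrow> O2_vs.subspace I"
  by (simp add: O2_mod.subspace_def O2_vs.subspace_def)

lemma coset_O2_eq_iff:
  assumes "O2_mod.subspace I"
  shows "I +>\<^bsub>O2\<^esub> f = I +>\<^bsub>O2\<^esub> g \<longleftrightarrow> f - g \<in> I"
proof -
  have *: "I +>\<^bsub>O2\<^esub> f = {x. x - f \<in> I}" for f
  proof -
    have "(\<exists>h\<in>I. x = h + f) \<longleftrightarrow> x - f \<in> I" for x
      by (metis add_diff_cancel_right' diff_add_cancel)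
    then show ?thesis by (auto simp: a_r_coset_def')
  qed
  show ?thesis
  proof
    assume "I +>\<^bsub>O2\<^esub> f = I +>\<^bsub>O2\<^esub> g"
    then show "f - g \<in> I" unfolding * using O2_mod.subspace_0[OF assms] by (metis diff_self mem_Collect_eq)
  next
    assume fg: "f - g \<in> I"
    have "x - f \<in> I \<longleftrightarrow> x - g \<in> I" for x
      using O2_mod.subspace_add[OF assms _ fg, of "x - f"]
        O2_mod.subspace_diff[OF assms _ fg, of "x - g"] by auto
    then show "I +>\<^bsub>O2\<^esub> f = I +>\<^bsub>O2\<^esub> g" by (simp add: *)
  qed
qed

text \<open>Both dimensions are built by adjoining one line at a time, and taking cosets matches
  chains of subspaces above \<open>I\<close> with chains in the quotient. This moves all later
  dimension counts into \<open>conv2\<close> itself.\<close>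

lemma dimension_Quot_iff:
  assumes I: "O2_mod.subspace I"
  defines "Q \<equiv> O2 Quot I" and "K \<equiv> range (\<lambda>c. I +>\<^bsub>O2\<^esub> const2 c)"
  shows "ring.dimension Q n K (carrier Q) \<longleftrightarrow> O2_vs.rel_dim n I UNIV"
proof -
  interpret I: ideal I O2 using I by (simp add: ideal_O2_iff)
  interpret Q: ring Q unfolding Q_def by (rule I.quotient_is_ring)
  define cos where "cos f = I +>\<^bsub>O2\<^esub> f" for f
  have cos_eq: "cos f = cos g \<longleftrightarrow> f - g \<in> I" for f g
    using coset_O2_eq_iff[OF I] by (simp add: cos_def)
  have cos_add: "cos f \<oplus>\<^bsub>Q\<^esub> cos g = cos (f + g)" for f g
    using I.a_rcos_sum[of f g] by (simp add: cos_def Q_def FactRing_def)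
  have cos_mult: "cos f \<otimes>\<^bsub>Q\<^esub> cos g = cos (f * g)" for f g
    using I.rcoset_mult_add[of f g] by (simp add: cos_def Q_def FactRing_def)
  have carrier: "carrier Q = range cos"
    by (auto simp: Q_def FactRing_def A_RCOSETS_def' cos_def)
  have "cos 0 = I"
    by (auto simp: cos_def a_r_coset_def')
  then have cos_zero: "\<zero>\<^bsub>Q\<^esub> = cos 0" by (simp add: Q_def FactRing_def)
  have K: "K = range (\<lambda>c. cos (const2 c))" by (simp add: K_def cos_def)
  have line: "Q.line_extension K (cos v) (cos ` V) = cos ` O2_vs.span (insert v V)"
    if V: "O2_vs.subspace V" for v V
  proof (rule Set.set_eqI)
    fix u
    have "u \<in> Q.line_extension K (cos v) (cos ` V)
        \<longleftrightarrow> (\<exists>c. \<exists>w\<in>V. u = cos (const2 c * v + w))"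
      unfolding Q.line_extension_mem_iff K by (auto simp: cos_mult cos_add)
    also have "\<dots> \<longleftrightarrow> u \<in> cos ` O2_vs.span (insert v V)"
    proof
      assume "\<exists>c. \<exists>w\<in>V. u = cos (const2 c * v + w)"
      then obtain c w where w: "w \<in> V" and u: "u = cos (const2 c * v + w)" by blast
      have "const2 c * v + w \<in> O2_vs.span (insert v V)"
        using w O2_vs.mem_span_insert_subspace[OF V] by (metis add_diff_cancel_left')
      then show "u \<in> cos ` O2_vs.span (insert v V)" using u by blast
    next
      assume "u \<in> cos ` O2_vs.span (insert v V)"
      then obtain x c where x: "x - const2 c * v \<in> V" and u: "u = cos x"
        using O2_vs.mem_span_insert_subspace[OF V] by blast
      have "x = const2 c * v + (x - const2 c * v)" by simp
      then show "\<exists>c. \<exists>w\<in>V. u = cos (const2 c * v + w)" using x u by metis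
    qed
    finally show "u \<in> Q.line_extension K (cos v) (cos ` V) \<longleftrightarrow> u \<in> cos ` O2_vs.span (insert v V)" .
  qed
  have to: "\<exists>V. O2_vs.rel_dim n I V \<and> E = cos ` V" if "Q.dimension n K' E" "K' = K" for K' E
    using that
  proof (induction rule: Q.dimension.induct)
    case (zero_dim K)
    have "cos ` I = {cos 0}"
      using cos_eq O2_mod.subspace_0[OF I] by (auto simp: image_iff) (metis diff_zero)+
    then show ?case
      using O2_vs.rel_dim_0[OF subspace_O2_mod_imp_vs[OF I]] cos_zero by auto
  next
    case (Suc_dim v E n K')
    then obtain V where V: "O2_vs.rel_dim n I V" "E = cos ` V" by blast
    obtain f where f: "v = cos f" using Suc_dim(1) carrier by auto
    then have "f \<notin> V" using Suc_dim(2) V by blast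
    then have "O2_vs.rel_dim (Suc n) I (O2_vs.span (insert f V))"
      by (rule O2_vs.rel_dim_Suc[OF V(1)])
    then show ?case
      using line[of V f] O2_vs.rel_dim_subspace(2)[OF V(1)] V(2) f Suc_dim.prems by auto
  qed
  have from_rel: "Q.dimension n K (cos ` V)" if "O2_vs.rel_dim n U V" "U = I" for U V
    using that
  proof (induction rule: O2_vs.rel_dim.induct)
    case (rel_dim_0 U)
    have "cos ` I = {cos 0}"
      using cos_eq O2_mod.subspace_0[OF I] by (auto simp: image_iff) (metis diff_zero)+
    then show ?case using cos_zero rel_dim_0 by (metis Q.zero_dim)
  next
    case (rel_dim_Suc n U V v)
    then have V: "O2_vs.subspace V" "I \<subseteq> V" using O2_vs.rel_dim_subspace by blast+
    have "cos v \<notin> cos ` V"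
    proof
      assume "cos v \<in> cos ` V"
      then obtain w where "w \<in> V" "v - w \<in> V" using cos_eq V by auto
      then show False using rel_dim_Suc V O2_vs.subspace_add by (metis diff_add_cancel)
    qed
    then show ?case
      using rel_dim_Suc Q.Suc_dim[of "cos v" "cos ` V" n K] line[OF V(1)] carrier by auto
  qed
  show ?thesis
  proof
    assume dim: "Q.dimension n K (carrier Q)"
    obtain V where V: "O2_vs.rel_dim n I V" "range cos = cos ` V"
      using to[OF dim refl] unfolding carrier by blast
    \<comment> \<open>Equality of coset images gives \<open>V = UNIV\<close> because
      \<open>V\<close> contains \<open>I\<close>.\<close>
    have "f \<in> V" for f
    proof -
      obtain w where "w \<in> V" "f - w \<in> I" using V(2) cos_eq by (metis UNIV_I image_iff)
      then show ?thesis using O2_vs.rel_dim_subspace[OF V(1)] O2_vs.subspace_add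
        by (metis diff_add_cancel subsetD)
    qed
    then show "O2_vs.rel_dim n I UNIV" using V(1) by (metis UNIV_eq_I)
  qed (use from_rel carrier in auto)
qed

lemma quot_dim_eq:
  "quot_dim S = (if \<exists>n. O2_vs.rel_dim n (O2_mod.span S) UNIV
     then enat (THE n. O2_vs.rel_dim n (O2_mod.span S) UNIV) else \<infinity>)"
  unfolding quot_dim_def Let_def Idl_O2_eq_span
  by (simp only: dimension_Quot_iff[OF O2_mod.subspace_span])

lemma quot_dim_eq_enat:
  "O2_vs.rel_dim n (O2_mod.span S) UNIV \<Longrightarrow> quot_dim S = enat n"
  unfolding quot_dim_eq using O2_vs.rel_dim_unique by (auto intro!: the_equality)

lemma quot_dim_eq_infinity:
  "(\<And>n. \<not> O2_vs.rel_dim n (O2_mod.span S) UNIV) \<Longrightarrow> quot_dim S = \<infinity>"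
  unfolding quot_dim_eq by simp

lemma quot_dim_cong: "O2_mod.span S = O2_mod.span T \<Longrightarrow> quot_dim S = quot_dim T"
  by (simp add: quot_dim_eq)

section \<open>Cancellation of \<open>g\<close> modulo \<open>h\<close>, and the dimension formula
  for \<open>(g p, g q, h)\<close>\<close>

lemma mem_span2: "x \<in> O2_mod.span {a, b} \<longleftrightarrow> (\<exists>u v. x = u * a + v * b)"
  by (simp add: O2_mod.span_insert diff_diff_eq diff_eq_eq add_ac)

lemma mem_span3: "x \<in> O2_mod.span {a, b, c} \<longleftrightarrow> (\<exists>u v w. x = u * a + v * b + w * c)"
  by (simp add: O2_mod.span_insert diff_diff_eq diff_eq_eq add_ac)

text \<open>
  Otherwise \<open>z\<^sup>n, z\<^sup>n\<^sup>-\<^sup>1, \<dots>, 1\<close> are \<open>n + 1\<close> elements of the quotient that are linearly independent.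
\<close>

lemma finite_codim_power:
  assumes A: "O2_mod.subspace A" and fin: "O2_vs.rel_dim n A UNIV"
  shows "\<exists>k s. z ^ k * (1 - z * s) \<in> A"
proof (rule ccontr)
  assume no: "\<not> ?thesis"
  \<comment> \<open>The powers are adjoined from \<open>z ^ n\<close> downwards, so that
    \<open>V\<close> stays inside \<open>A\<close> plus the multiples of
    \<open>z ^ (Suc n - i)\<close>. If the next lower power were already in \<open>V\<close>, it
    would yield a relation excluded by \<open>no\<close>.\<close>
  have "\<exists>V. O2_vs.rel_dim i A V \<and> (\<forall>x\<in>V. \<exists>s. x - z ^ (Suc n - i) * s \<in> A)" if "i \<le> Suc n" for i
    using that
  proof (induction i)
    case 0
    have "\<forall>x\<in>A. \<exists>s. x - z ^ Suc n * s \<in> A" by (metis diff_zero mult_zero_right)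
    then show ?case using O2_vs.rel_dim_0[OF subspace_O2_mod_imp_vs[OF A]] by auto
  next
    case (Suc i)
    define j where "j = n - i"
    have j: "Suc n - i = Suc j" "Suc n - Suc i = j" using Suc.prems by (auto simp: j_def)
    obtain V where V: "O2_vs.rel_dim i A V" "\<And>x. x \<in> V \<Longrightarrow> \<exists>s. x - z ^ Suc j * s \<in> A"
      using Suc j by auto
    have "z ^ j \<notin> V"
    proof
      assume "z ^ j \<in> V"
      then obtain s where "z ^ j - z ^ Suc j * s \<in> A" using V by blast
      then have "z ^ j * (1 - z * s) \<in> A" by (simp add: algebra_simps)
      then show False using no by blast
    qed
    moreover have "\<exists>s. x - z ^ j * s \<in> A" if x: "x \<in> O2_vs.span (insert (z ^ j) V)" for x
    proof -
      obtain c where "x - const2 c * z ^ j \<in> V"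
        using x O2_vs.mem_span_insert_subspace O2_vs.rel_dim_subspace[OF V(1)] by blast
      then obtain s where "x - const2 c * z ^ j - z ^ Suc j * s \<in> A" using V by blast
      then have "x - z ^ j * (const2 c + z * s) \<in> A" by (simp add: algebra_simps)
      then show ?thesis by blast
    qed
    ultimately show ?case using O2_vs.rel_dim_Suc[OF V(1)] j by metis
  qed
  then obtain V where "O2_vs.rel_dim (Suc n) A V" by blast
  then have "Suc n \<le> n" using O2_vs.rel_dim_mono fin by blast
  then show False by simp
qed

text \<open>
  \<open>h\<close> divides \<open>a b\<close> for every \<open>a \<in> (g, h)\<close>, in particular for \<open>a = x\<^sup>k\<close> and for some \<open>a\<close> that is not
  divisible by \<open>x\<close>; comparing the two factorisations removes \<open>x\<^sup>k\<close>.
\<close>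

lemma dvd_mult_cancel_if_finite_codim:
  assumes fin: "O2_vs.rel_dim n (O2_mod.span {g, h}) UNIV" and dvd: "h dvd g * b"
  shows "h dvd b"
proof -
  have mult: "h dvd a * b" if a: "a \<in> O2_mod.span {g, h}" for a
  proof -
    obtain u v where "a = u * g + v * h" using a by (auto simp: mem_span2)
    then have "a * b = u * (g * b) + h * (v * b)" by (simp add: algebra_simps)
    then show ?thesis using dvd by simp
  qed
  obtain k s where "var_x ^ k * (1 - var_x * s) \<in> O2_mod.span {g, h}"
    using finite_codim_power[OF O2_mod.subspace_span fin] by blast
  then have "h dvd (1 - var_x * s) * (var_x ^ k * b)"
    using mult by (metis mult.assoc mult.commute)
  then have "h dvd var_x ^ k * b"
    using one_minus_var_x_mult_unit[of s] by (metis dvd_mult_unit_iff' dvd_trans dvd_refl mult.commute)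
  then obtain p where p: "var_x ^ k * b = h * p" by blast
  obtain l t where lt: "var_y ^ l * (1 - var_y * t) \<in> O2_mod.span {g, h}"
    using finite_codim_power[OF O2_mod.subspace_span fin] by blast
  \<comment> \<open>This is the element of \<open>(g, h)\<close> not divisible by \<open>x\<close>:
    at \<open>x = 0\<close> it is a power of \<open>y\<close> times a series with constant term
    1.\<close>
  define u where "u = var_y ^ l * (1 - var_y * t)"
  have "fps_nth (series_of u) 0 \<noteq> 0"
  proof -
    have "fps_nth (series_of (var_y ^ l)) 0 = fps_X ^ l"
      by (induction l) (simp_all add: one_conv2.rep_eq times_conv2.rep_eq var_y.rep_eq)
    moreover have "fps_nth (fps_nth (series_of (1 - var_y * t)) 0) 0 = 1"
      by (simp add: one_conv2.rep_eq times_conv2.rep_eq minus_conv2.rep_eq var_y.rep_eq)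
    ultimately show ?thesis by (auto simp: u_def times_conv2.rep_eq)
  qed
  moreover obtain q where q: "u * b = h * q" using mult lt u_def by blast
  \<comment> \<open>Both sides equal \<open>var_x ^ k * u * b\<close>.\<close>
  have "h * (p * u) = h * (var_x ^ k * q)"
    using p q by (metis mult.assoc mult.commute mult.left_commute)
  show ?thesis
  proof (cases "h = 0")
    case True
    then have "b = 0" using q \<open>fps_nth (series_of u) 0 \<noteq> 0\<close> by (auto simp: zero_conv2.rep_eq)
    then show ?thesis by simp
  next
    case False
    then have "var_x ^ k dvd p * u" using \<open>h * (p * u) = _\<close> by simp
    then obtain r where "p = var_x ^ k * r"
      using var_x_power_dvd_mult_cancel \<open>fps_nth (series_of u) 0 \<noteq> 0\<close> by blast
    then have "var_x ^ k * b = var_x ^ k * (h * r)" using p by (simp add: mult_ac)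
    moreover have "var_x \<noteq> 0" by transfer simp
    ultimately show ?thesis by simp
  qed
qed

text \<open>The codimension of \<open>J\<close> is split along \<open>J \<subseteq> A\<close>. If
  \<open>A\<close> or \<open>T\<close> has infinite codimension, then so has \<open>J\<close>: the
  first by enlarging \<open>J\<close> to \<open>A\<close>, the second by pulling \<open>J\<close>
  back along multiplication by \<open>g\<close>.\<close>

lemma quot_dim_mult:
  "quot_dim {g * p, g * q, h} = quot_dim {g, h} + quot_dim {h, p, q}"
proof -
  define J where "J = O2_mod.span {g * p, g * q, h}"
  define A where "A = O2_mod.span {g, h}"
  define T where "T = O2_mod.span {h, p, q}"
  have sub: "O2_vs.subspace J" "O2_vs.subspace A" "O2_vs.subspace T"
    by (simp_all add: J_def A_def T_def subspace_O2_mod_imp_vs)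
  have JA: "J \<subseteq> A" unfolding J_def A_def
    by (rule O2_mod.span_minimal)
      (auto simp: O2_mod.span_base O2_mod.subspace_span mem_span2 intro: exI[of _ p] exI[of _ q] exI[of _ 0])
  have hom: "module_hom (\<lambda>c f. const2 c * f) (\<lambda>c f. const2 c * f) ((*) g)"
    by unfold_locales (simp_all add: algebra_simps)
  show ?thesis
  proof (cases "\<exists>n. O2_vs.rel_dim n A UNIV")
    case False
    have "\<not> O2_vs.rel_dim n J UNIV" for n
    proof
      assume "O2_vs.rel_dim n J UNIV"
      from O2_vs.rel_dim_sup[OF this sub(2) JA] False show False by simp
    qed
    then show ?thesis
      using False quot_dim_eq_infinity[of "{g, h}"] quot_dim_eq_infinity[of "{g * p, g * q, h}"]
      by (simp add: J_def A_def)
  next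
    case True
    then obtain n where n: "O2_vs.rel_dim n A UNIV" by blast
    \<comment> \<open>Subtracting the multiples of \<open>p\<close> and \<open>q\<close> leaves an
      element whose product with \<open>g\<close> is divisible by \<open>h\<close>; cancelling
      \<open>g\<close> shows that it lies in \<open>(h)\<close>.\<close>
    have vimage: "(*) g -` J = T"
    proof (intro subset_antisym subsetI)
      fix a assume "a \<in> (*) g -` J"
      then obtain u v w where "g * a = u * (g * p) + v * (g * q) + w * h"
        by (auto simp: J_def mem_span3)
      then have "g * (a - u * p - v * q) = h * w" by (simp add: algebra_simps)
      then have "h dvd a - u * p - v * q"
        using dvd_mult_cancel_if_finite_codim n unfolding A_def by (metis dvd_triv_left)
      then obtain r where "a - u * p - v * q = h * r" by blast
      then have "a = r * h + u * p + v * q" by (simp add: algebra_simps diff_eq_eq)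
      then show "a \<in> T" by (auto simp: T_def mem_span3)
    next
      fix a assume "a \<in> T"
      then obtain u v w where "a = u * h + v * p + w * q" by (auto simp: T_def mem_span3)
      then have "g * a = v * (g * p) + w * (g * q) + (g * u) * h" by (simp add: algebra_simps)
      then show "a \<in> (*) g -` J" unfolding J_def vimage_def mem_Collect_eq mem_span3 by blast
    qed
    have image: "O2_vs.span (range ((*) g) \<union> J) = A"
    proof (intro subset_antisym O2_vs.span_minimal sub subsetI)
      fix a assume "a \<in> A"
      then obtain u v where a: "a = g * u + v * h" by (auto simp: A_def mem_span2 mult.commute)
      have "v * h \<in> J" unfolding J_def by (simp add: O2_mod.span_scale O2_mod.span_base)
      then show "a \<in> O2_vs.span (range ((*) g) \<union> J)"
        unfolding a by (intro O2_vs.span_add O2_vs.span_base) auto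
    next
      have "x * g \<in> A" for x unfolding A_def by (simp add: O2_mod.span_scale O2_mod.span_base)
      then show "a \<in> A" if "a \<in> range ((*) g) \<union> J" for a
        using JA that by (auto simp: mult.commute)
    qed
    show ?thesis
    proof (cases "\<exists>m. O2_vs.rel_dim m T UNIV")
      case True
      then obtain m where m: "O2_vs.rel_dim m T UNIV" by blast
      have "O2_vs.rel_dim m J A"
        using O2_vs.rel_dim_image[OF m hom sub(1) vimage] image by simp
      then have "O2_vs.rel_dim (m + n) J UNIV"
        by (rule O2_vs.rel_dim_trans[OF n])
      then show ?thesis
        using m n quot_dim_eq_enat by (simp add: A_def J_def T_def add.commute)
    next
      case False
      have "\<not> O2_vs.rel_dim m J UNIV" for m
      proof
        assume "O2_vs.rel_dim m J UNIV"
        from O2_vs.rel_dim_vimage[OF this hom] False vimage show False by simp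
      qed
      then show ?thesis
        using False quot_dim_eq_infinity[of "{h, p, q}"] quot_dim_eq_infinity[of "{g * p, g * q, h}"]
        by (simp add: J_def T_def)
    qed
  qed
qed

section \<open>Tjurina numbers of members of the pencil\<close>

lemma deriv_pencil_member:
  "deriv_x (pencil_member \<alpha> \<beta> f g) = pencil_member \<alpha> \<beta> (deriv_x f) (deriv_x g)"
  "deriv_y (pencil_member \<alpha> \<beta> f g) = pencil_member \<alpha> \<beta> (deriv_y f) (deriv_y g)"
  unfolding pencil_member_def
   apply transfer
  subgoal by (simp flip: fps_const_mult)
  apply transfer
  subgoal by (rule fps_ext) simp
  done

text \<open>The identity \<open>g dh = \<alpha> \<omega> + h dg\<close>, with
  \<open>\<omega>\<close> the form \<open>g df - f dg\<close>, shows that modulo \<open>h\<close>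
  the coefficients of \<open>g dh\<close> and of \<open>\<omega>\<close> differ by the unit
  \<open>\<alpha>\<close>. Solving \<open>h = \<alpha> f + \<beta> g\<close> for \<open>f\<close>
  likewise gives \<open>(f, g) = (g, h)\<close>, so \<open>quot_dim_mult\<close> applies with the
  partial derivatives of \<open>h\<close> as \<open>p\<close> and \<open>q\<close>.\<close>

lemma tjurina_pencil_if_nonzero:
  assumes "\<alpha> \<noteq> 0"
  shows "tjurina_pencil \<alpha> \<beta> f g = intersection_mult f g + tjurina (pencil_member \<alpha> \<beta> f g)"
proof -
  define h where "h = pencil_member \<alpha> \<beta> f g"
  define c where "c = const2 (inverse \<alpha>)"
  have c: "c * const2 \<alpha> = 1" using assms by (simp add: c_def flip: const2_mult)
  have inv: "x = c * y" if "y = const2 \<alpha> * x" for x y using c that by (simp flip: mult.assoc)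
  have wx: "g * deriv_x h = const2 \<alpha> * omega_x f g + deriv_x g * h"
    unfolding h_def deriv_pencil_member by (simp add: pencil_member_def omega_x_def algebra_simps)
  have wy: "g * deriv_y h = const2 \<alpha> * omega_y f g + deriv_y g * h"
    unfolding h_def deriv_pencil_member by (simp add: pencil_member_def omega_y_def algebra_simps)
  have wx': "omega_x f g = c * (g * deriv_x h) + (- c * deriv_x g) * h"
    using inv[of "g * deriv_x h - deriv_x g * h" "omega_x f g"] wx by (simp add: algebra_simps)
  have wy': "omega_y f g = c * (g * deriv_y h) + (- c * deriv_y g) * h"
    using inv[of "g * deriv_y h - deriv_y g * h" "omega_y f g"] wy by (simp add: algebra_simps)
  have f: "f = c * h + (- c * const2 \<beta>) * g"
    using inv[of "h - const2 \<beta> * g" f] by (simp add: h_def pencil_member_def algebra_simps)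
  have J: "O2_mod.span {omega_x f g, omega_y f g, h} = O2_mod.span {g * deriv_x h, g * deriv_y h, h}"
    unfolding O2_mod.span_eq
  proof (intro conjI insert_subsetI empty_subsetI)
    show "omega_x f g \<in> O2_mod.span {g * deriv_x h, g * deriv_y h, h}"
      unfolding wx' by (intro O2_mod.span_add O2_mod.span_scale O2_mod.span_base) auto
    show "omega_y f g \<in> O2_mod.span {g * deriv_x h, g * deriv_y h, h}"
      unfolding wy' by (intro O2_mod.span_add O2_mod.span_scale O2_mod.span_base) auto
    show "g * deriv_x h \<in> O2_mod.span {omega_x f g, omega_y f g, h}"
      unfolding wx by (intro O2_mod.span_add O2_mod.span_scale O2_mod.span_base) auto
    show "g * deriv_y h \<in> O2_mod.span {omega_x f g, omega_y f g, h}"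
      unfolding wy by (intro O2_mod.span_add O2_mod.span_scale O2_mod.span_base) auto
  qed (auto intro: O2_mod.span_base)
  have A: "O2_mod.span {f, g} = O2_mod.span {g, h}"
    unfolding O2_mod.span_eq
  proof (intro conjI insert_subsetI empty_subsetI)
    show "f \<in> O2_mod.span {g, h}"
      by (subst f) (intro O2_mod.span_add O2_mod.span_scale O2_mod.span_base; simp)
    show "h \<in> O2_mod.span {f, g}"
      unfolding h_def pencil_member_def
      by (intro O2_mod.span_add O2_mod.span_scale O2_mod.span_base) auto
  qed (auto intro: O2_mod.span_base)
  show ?thesis
    unfolding tjurina_pencil_def intersection_mult_def tjurina_def h_def[symmetric]
      quot_dim_cong[OF J] quot_dim_cong[OF A]
    by (rule quot_dim_mult)
qed

text \<open>Exchanging \<open>f\<close> and \<open>g\<close> only changes the sign of the form. This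
  reduces the fiber with \<open>\<alpha> = 0\<close> to the case of a nonzero first
  coefficient.\<close>

lemma tjurina_pencil_swap: "tjurina_pencil \<beta> \<alpha> g f = tjurina_pencil \<alpha> \<beta> f g"
proof -
  have "omega_x g f = - omega_x f g" "omega_y g f = - omega_y f g"
    by (simp_all add: omega_x_def omega_y_def)
  moreover have "pencil_member \<beta> \<alpha> g f = pencil_member \<alpha> \<beta> f g"
    by (simp add: pencil_member_def)
  moreover have "quot_dim {- a, - b, h} = quot_dim {a, b, h}" for a b h
  proof (rule quot_dim_cong)
    have "- (- a) \<in> O2_mod.span {- a, - b, h}" "- (- b) \<in> O2_mod.span {- a, - b, h}"
      by (rule O2_mod.span_neg; simp add: O2_mod.span_base)+
    then show "O2_mod.span {- a, - b, h} = O2_mod.span {a, b, h}"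
      unfolding O2_mod.span_eq by (auto intro: O2_mod.span_neg O2_mod.span_base)
  qed
  ultimately show ?thesis by (simp add: tjurina_pencil_def)
qed

theorem proposition2p3:
  fixes f g :: conv2 and \<alpha> \<beta> :: complex
  assumes "coprime f g"
    and "omega_isolated f g"
    and "(\<alpha>, \<beta>) \<noteq> (0, 0)"
    and "squarefree (pencil_member \<alpha> \<beta> f g)"
  shows "tjurina_pencil \<alpha> \<beta> f g
       = intersection_mult f g + tjurina (pencil_member \<alpha> \<beta> f g)"
proof (cases "\<alpha> = 0")
  case False
  then show ?thesis by (rule tjurina_pencil_if_nonzero)
next
  case True
  then have "\<beta> \<noteq> 0" using assms(3) by simp
  then show ?thesis
    using tjurina_pencil_if_nonzero[of \<beta> \<alpha> g f]
    by (simp add: tjurina_pencil_swap intersection_mult_def insert_commute pencil_member_def add.commute)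
qed

end
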